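(* Let $\mathcal H=\mathcal H_0\oplus\mathcal H_1$, $A$, $W$, $V$, $X$, $Y$ be as in the context. (a) Let the graph subspace $\mathcal G(\mathcal H_0,X)$ be reducing for the operator $A+V$. Then $Y$ is a strong solution to the operator Riccati equation $AY-YA-YVY+V=0$ if there is some constant $\lambda$ such that $A+V-\lambda$ is injective and $A-YV-\lambda$ is surjective. (b) Let $Y$ be a strong solution to the operator Riccati equation $AY-YA-YVY+V=0$. Then the graph subspace $\mathcal G(\mathcal H_0,X)$ is reducing for $A+V$ if there is some constant $\lambda$ such that $A+V-\lambda$ is surjective and $A-YV-\lambda$ is injective.
   Context: Hilbert spaces are complex, and constants $\lambda$ are complex scalars ($\lambda$ also denotes $\lambda I_{\mathcal H}$). Setting: $\mathcal H=\mathcal H_0\oplus\mathcal H_1$ is a Hilbert space decomposed into two orthogonal subspaces. $A=\begin{pmatrix}A_0&0\\0&A_1\end{pmatrix}$ with $\mathrm{Dom}(A)=\mathrm{Dom}(A_0)\oplus\mathrm{Dom}(A_1)$ is a (possibly unbounded) self-adjoint operator on $\mathcal H$. $W\colon\mathcal H_1\supset\mathrm{Dom}(W)\to\mathcal H_0$ is a densely defined linear operator with $\mathrm{Dom}(W)\supset\mathrm{Dom}(A_1)$ and $\mathrm{Dom}(W^* )\supset\mathrm{Dom}(A_0)$, and $V=\begin{pmatrix}0&W\\ W^*&0\end{pmatrix}$ on $\mathrm{Dom}(V)=\mathrm{Dom}(W^* )\oplus\mathrm{Dom}(W)\supset\mathrm{Dom}(A)$. $X\colon\mathcal H_0\to\mathcal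 H_1$ is a bounded linear operator, and $Y=\begin{pmatrix}0&-X^*\\ X&0\end{pmatrix}$, a bounded operator on $\mathcal H$. Sums and products of operators have their natural domains, so $\mathrm{Dom}(A+V)=\mathrm{Dom}(A)=\mathrm{Dom}(A-YV)$. Injectivity and surjectivity of $A+V-\lambda$ and $A-YV-\lambda$ are understood as maps from $\mathrm{Dom}(A)$ to $\mathcal H$. Graph subspaces: $\mathcal G(\mathcal H_0,X)=\{f\oplus Xf:f\in\mathcal H_0\}$, a closed subspace with orthogonal complement $\mathcal G(\mathcal H_1,-X^* )=\{-X^*g\oplus g:g\in\mathcal H_1\}$. A closed subspace $\mathcal G\subset\mathcal H$ is invariant for a linear operator $B$ if $Bx\in\mathcal G$ for all $x\in\mathrm{Dom}(B)\cap\mathcal G$. It is reducing for $B$ if $\mathcal G$ and $\mathcal G^\perp$ are both invariant for $B$ and $\mathrm{Dom}(B)=(\mathrm{Dom}(B)\cap\mathcal G)+(\mathrm{Dom}(B)\cap\mathcal G^\perp)$. $Y$ is a strong solution to the operator Riccati equation $AY-YA-YVY+V=0$ if $Yx\in\mathrm{Dom}(A)$ and $AYx-YAx-YVYx+Vx=0$ for all $x\in\mathrm{Dom}(A)$. *)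

theory Defs
  imports "HOL-Analysis.Analysis"
begin

section \<open>Complex Hilbert spaces\<close>

class complex_vector = real_vector +
  fixes scaleC :: "complex \<Rightarrow> 'a \<Rightarrow> 'a"  (infixr "*\<^sub>C" 75)
  assumes scaleC_add_right: "c *\<^sub>C (x + y) = c *\<^sub>C x + c *\<^sub>C y"
    and scaleC_add_left: "(c + d) *\<^sub>C x = c *\<^sub>C x + d *\<^sub>C x"
    and scaleC_scaleC: "c *\<^sub>C d *\<^sub>C x = (c * d) *\<^sub>C x"
    and scaleR_scaleC: "r *\<^sub>R x = complex_of_real r *\<^sub>C x"

text \<open>The inner product is antilinear in its first argument.  Definiteness, and the fact that
  the norm is the one induced by \<open>cinner\<close>, come from \<^class>\<open>real_inner\<close> through
  \<open>inner_eq_Re_cinner\<close>.\<close>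

class complex_inner = complex_vector + real_inner +
  fixes cinner :: "'a \<Rightarrow> 'a \<Rightarrow> complex"
  assumes cinner_commute: "cinner x y = cnj (cinner y x)"
    and cinner_add_right: "cinner x (y + z) = cinner x y + cinner x z"
    and cinner_scaleC_right: "cinner x (c *\<^sub>C y) = c * cinner x y"
    and inner_eq_Re_cinner: "inner x y = Re (cinner x y)"

class chilbert_space = complex_inner + complete_space

instantiation complex :: chilbert_space
begin

definition scaleC_complex :: "complex \<Rightarrow> complex \<Rightarrow> complex" where
  "scaleC_complex c x = c * x"

definition cinner_complex :: "complex \<Rightarrow> complex \<Rightarrow> complex" where
  "cinner_complex x y = cnj x * y"

instance
  by standard
    (auto simp: scaleC_complex_def cinner_complex_def algebra_simps scaleR_conv_of_real
      inner_complex_def)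

end

text \<open>The orthogonal direct sum \<open>H\<^sub>0 \<oplus> H\<^sub>1\<close> is the product type.\<close>

instantiation prod :: (complex_vector, complex_vector) complex_vector
begin

definition scaleC_prod :: "complex \<Rightarrow> 'a \<times> 'b \<Rightarrow> 'a \<times> 'b" where
  "scaleC_prod c x = (c *\<^sub>C fst x, c *\<^sub>C snd x)"

instance
  by standard
    (auto simp: scaleC_prod_def prod_eq_iff scaleC_add_right scaleC_add_left scaleC_scaleC
      scaleR_scaleC)

end

instantiation prod :: (complex_inner, complex_inner) complex_inner
begin

definition cinner_prod :: "'a \<times> 'b \<Rightarrow> 'a \<times> 'b \<Rightarrow> complex" where
  "cinner_prod x y = cinner (fst x) (fst y) + cinner (snd x) (snd y)"

instance
proof
  fix x y z :: "'a \<times> 'b" and c :: complex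
  show "cinner x y = cnj (cinner y x)"
    unfolding cinner_prod_def complex_cnj_add
    using cinner_commute[of "fst x" "fst y"] cinner_commute[of "snd x" "snd y"] by simp
qed (auto simp: cinner_prod_def scaleC_prod_def cinner_add_right cinner_scaleC_right
      inner_eq_Re_cinner algebra_simps inner_prod_def)

end

instance prod :: (chilbert_space, chilbert_space) chilbert_space ..

definition csubspace :: "'a::complex_vector set \<Rightarrow> bool" where
  "csubspace S \<longleftrightarrow> 0 \<in> S \<and> (\<forall>x\<in>S. \<forall>y\<in>S. x + y \<in> S) \<and> (\<forall>c. \<forall>x\<in>S. c *\<^sub>C x \<in> S)"

definition orth_compl :: "'a::complex_inner set \<Rightarrow> 'a set" where
  "orth_compl G = {y. \<forall>x\<in>G. cinner x y = 0}"


section \<open>Unbounded operators\<close>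

text \<open>An operator \<open>T\<close> with domain in \<open>'a\<close> and values in \<open>'b\<close> is a partial map:
  \<open>dom T\<close> is its domain, \<open>ran T\<close> its range, and the product with its
  natural domain is \<open>S \<circ>\<^sub>m T\<close>.  An equation between two operators includes the
  equality of their domains.\<close>

definition linear_op :: "('a::complex_vector \<rightharpoonup> 'b::complex_vector) \<Rightarrow> bool" where
  "linear_op T \<longleftrightarrow> csubspace (dom T) \<and>
     (\<forall>x\<in>dom T. \<forall>y\<in>dom T. the (T (x + y)) = the (T x) + the (T y)) \<and>
     (\<forall>c. \<forall>x\<in>dom T. the (T (c *\<^sub>C x)) = c *\<^sub>C the (T x))"

definition densely_defined :: "('a::topological_space \<rightharpoonup> 'b) \<Rightarrow> bool" where
  "densely_defined T \<longleftrightarrow> closure (dom T) = UNIV"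

definition total_op :: "('a \<Rightarrow> 'b) \<Rightarrow> ('a \<rightharpoonup> 'b)" where
  "total_op F = (\<lambda>x. Some (F x))"

definition op_add :: "('a \<rightharpoonup> 'b::plus) \<Rightarrow> ('a \<rightharpoonup> 'b) \<Rightarrow> ('a \<rightharpoonup> 'b)"  (infixl "\<^bold>+" 65) where
  "S \<^bold>+ T = (\<lambda>x. if x \<in> dom S \<inter> dom T then Some (the (S x) + the (T x)) else None)"

definition op_diff :: "('a \<rightharpoonup> 'b::minus) \<Rightarrow> ('a \<rightharpoonup> 'b) \<Rightarrow> ('a \<rightharpoonup> 'b)"  (infixl "\<^bold>-" 65) where
  "S \<^bold>- T = (\<lambda>x. if x \<in> dom S \<inter> dom T then Some (the (S x) - the (T x)) else None)"

definition scalar_op :: "complex \<Rightarrow> ('a::complex_vector \<rightharpoonup> 'a)" where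
  "scalar_op c = total_op (\<lambda>x. c *\<^sub>C x)"

text \<open>The vector \<open>z\<close> below is unique when \<open>T\<close> is densely defined; the definition is only
  meaningful for such \<open>T\<close>.\<close>

definition adj :: "('a::complex_inner \<rightharpoonup> 'b::complex_inner) \<Rightarrow> ('b \<rightharpoonup> 'a)" where
  "adj T = (\<lambda>y. if \<exists>z. \<forall>x\<in>dom T. cinner (the (T x)) y = cinner x z
                 then Some (THE z. \<forall>x\<in>dom T. cinner (the (T x)) y = cinner x z)
                 else None)"

definition self_adjoint :: "('a::complex_inner \<rightharpoonup> 'a) \<Rightarrow> bool" where
  "self_adjoint T \<longleftrightarrow> linear_op T \<and> densely_defined T \<and> adj T = T"

definition bounded_clinear :: "('a::complex_inner \<Rightarrow> 'b::complex_inner) \<Rightarrow> bool" where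
  "bounded_clinear F \<longleftrightarrow> bounded_linear F \<and> (\<forall>c x. F (c *\<^sub>C x) = c *\<^sub>C F x)"

text \<open>By the Riesz representation theorem \<open>adj (total_op F)\<close> is everywhere defined for bounded
  \<open>F\<close>, so \<open>the\<close> is harmless here.\<close>

definition bounded_adj :: "('a::chilbert_space \<Rightarrow> 'b::chilbert_space) \<Rightarrow> ('b \<Rightarrow> 'a)" where
  "bounded_adj F = (\<lambda>y. the (adj (total_op F) y))"


section \<open>Block operators, graph subspaces and the Riccati equation\<close>

definition block_diag :: "('a \<rightharpoonup> 'a) \<Rightarrow> ('b \<rightharpoonup> 'b) \<Rightarrow> ('a \<times> 'b \<rightharpoonup> 'a \<times> 'b)" where
  "block_diag A0 A1 = (\<lambda>(f, g). if f \<in> dom A0 \<and> g \<in> dom A1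
                                 then Some (the (A0 f), the (A1 g)) else None)"

text \<open>\<open>block_offdiag B C\<close> has upper right entry \<open>B\<close> and lower left entry \<open>C\<close>.\<close>

definition block_offdiag :: "('b \<rightharpoonup> 'a) \<Rightarrow> ('a \<rightharpoonup> 'b) \<Rightarrow> ('a \<times> 'b \<rightharpoonup> 'a \<times> 'b)" where
  "block_offdiag B C = (\<lambda>(f, g). if f \<in> dom C \<and> g \<in> dom B
                                  then Some (the (B g), the (C f)) else None)"

definition skew_block ::
  "('a::chilbert_space \<Rightarrow> 'b::chilbert_space) \<Rightarrow> ('a \<times> 'b \<Rightarrow> 'a \<times> 'b)" where
  "skew_block X = (\<lambda>(f, g). (- bounded_adj X g, X f))"

definition graph_subspace :: "('a \<Rightarrow> 'b) \<Rightarrow> ('a \<times> 'b) set" where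
  "graph_subspace X = {(f, X f) | f. True}"

definition invariant_for :: "'a set \<Rightarrow> ('a \<rightharpoonup> 'a) \<Rightarrow> bool" where
  "invariant_for G B \<longleftrightarrow> (\<forall>x\<in>dom B \<inter> G. the (B x) \<in> G)"

definition reducing_for :: "'a::complex_inner set \<Rightarrow> ('a \<rightharpoonup> 'a) \<Rightarrow> bool" where
  "reducing_for G B \<longleftrightarrow> closed G \<and> csubspace G \<and>
     invariant_for G B \<and> invariant_for (orth_compl G) B \<and>
     dom B = {u + v | u v. u \<in> dom B \<inter> G \<and> v \<in> dom B \<inter> orth_compl G}"

definition strong_riccati_solution ::
  "('a::ab_group_add \<rightharpoonup> 'a) \<Rightarrow> ('a \<rightharpoonup> 'a) \<Rightarrow> ('a \<Rightarrow> 'a) \<Rightarrow> bool" where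
  "strong_riccati_solution A V Y \<longleftrightarrow>
     (\<forall>x\<in>dom A. Y x \<in> dom A \<and>
        the (A (Y x)) - Y (the (A x)) - Y (the (V (Y x))) + the (V x) = 0)"

end

theory Submission imports Defs begin

text \<open>Write \<open>D = Dom A\<close> and \<open>T = I - Y\<close>.  Since \<open>Y\<close> is skew-adjoint, \<open>T\<close> is bijective.
  Wherever the Riccati equation holds one has \<open>(A - Y V - \<lambda>) T = T (A + V - \<lambda>)\<close>.  In (a), this is
  available on \<open>D' = {x \<in> D. Y x \<in> D}\<close>, and reducibility gives \<open>T D' = D\<close>; hence \<open>A + V - \<lambda>\<close> maps
  \<open>D'\<close> onto the whole space, and its injectivity on \<open>D\<close> forces \<open>D' = D\<close>.  In (b), \<open>A - Y V - \<lambda>\<close>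
  maps \<open>T D\<close> onto the whole space, and its injectivity forces \<open>T D = D\<close>, which is the splitting
  of \<open>D\<close> along the graph and its orthogonal complement.\<close>

section \<open>Complex inner products\<close>

lemma scaleC_diff_right: "c *\<^sub>C (x - y) = c *\<^sub>C x - c *\<^sub>C (y::'a::complex_vector)"
  using scaleC_add_right[of c "x - y" y] by (simp add: eq_diff_eq)

lemma scaleC_zero_right [simp]: "c *\<^sub>C 0 = (0::'a::complex_vector)"
  using scaleC_diff_right[of c 0 0] by simp

lemma scaleC_minus_right: "c *\<^sub>C (- x) = - (c *\<^sub>C (x::'a::complex_vector))"
  using scaleC_diff_right[of c 0 x] by simp

lemma scaleC_minus1_left: "(-1) *\<^sub>C x = - (x::'a::complex_vector)"
  using scaleR_scaleC[of "-1" x] by simp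

lemma cinner_scaleC_left: "cinner (c *\<^sub>C x) y = cnj c * cinner x (y::'a::complex_inner)"
  by (metis cinner_commute cinner_scaleC_right complex_cnj_mult)

lemma cinner_diff_right: "cinner x (y - z) = cinner x y - cinner x (z::'a::complex_inner)"
  using cinner_add_right[of x "y - z" z] by (simp add: eq_diff_eq)

lemma cinner_zero_right [simp]: "cinner x 0 = (0::complex)"
  using cinner_diff_right[of x 0 0] by simp

text \<open>Antilinearity in the first argument turns \<open>\<i>\<close> into \<open>-\<i>\<close>,
  and Re(-iw) = Im w. Complex identities can thus be checked through the real \<open>inner\<close>
  alone.\<close>

lemma Im_cinner: "Im (cinner x y) = inner (\<i> *\<^sub>C x) (y::'a::complex_inner)"
  by (simp add: inner_eq_Re_cinner cinner_scaleC_left)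

text \<open>The real hyperplane orthogonal to \<open>z\<close> is closed and contains
  \<open>S\<close>, hence contains \<open>z\<close> itself. This gives uniqueness of adjoint
  values.\<close>

lemma cinner_dense_eq_0:
  fixes z :: "'a::complex_inner"
  assumes "closure S = UNIV" and "\<And>x. x \<in> S \<Longrightarrow> cinner x z = 0"
  shows "z = 0"
proof -
  have "closed {x. inner x z = 0}"
    by (intro closed_Collect_eq continuous_intros)
  moreover have "S \<subseteq> {x. inner x z = 0}"
    using assms(2) by (auto simp: inner_eq_Re_cinner)
  ultimately have "closure S \<subseteq> {x. inner x z = 0}"
    by (rule closure_minimal[rotated])
  then have "z \<in> {x. inner x z = 0}"
    unfolding assms(1) by blast
  then show ?thesis by simp
qed

lemma cinner_all_eqD: "z = w" if "\<And>x. cinner x z = cinner x (w::'a::complex_inner)"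
  using cinner_dense_eq_0[of UNIV "z - w"] that by (simp add: cinner_diff_right)


section \<open>Bounded operators on Hilbert spaces\<close>

text \<open>The representing vector is the minimizer of \<open>\<parallel>x\<parallel>\<^sup>2 / 2 - f x\<close>.\<close>

lemma riesz_representation:
  fixes f :: "'a::{real_inner,complete_space} \<Rightarrow> real"
  assumes f: "bounded_linear f"
  shows "\<exists>z. \<forall>x. f x = inner x z"
proof -
  interpret f: bounded_linear f by (rule f)
  define q where "q x = (norm x)\<^sup>2 / 2 - f x" for x
  obtain K where K: "\<And>x. \<bar>f x\<bar> \<le> norm x * K" "K > 0"
    using f.pos_bounded by auto
  \<comment> \<open>Completing the square: \<open>q x\<close> is at least ((norm x - K)^2 - K^2) /
    2.\<close>
  have "q x \<ge> - K\<^sup>2 / 2" for x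
  proof -
    have "0 \<le> (norm x - K)\<^sup>2" by simp
    then show ?thesis
      using K(1)[of x] unfolding q_def by (simp add: power2_diff)
  qed
  then have bdd: "bdd_below (range q)"
    by (intro bdd_belowI[of _ "- K\<^sup>2 / 2"]) auto
  define m where "m = Inf (range q)"
  have m_le: "m \<le> q x" for x
    unfolding m_def by (rule cInf_lower) (auto simp: bdd)
  have "\<exists>x. q x < m + inverse (real (Suc n))" for n
    using cInf_lessD[of "range q" "m + inverse (real (Suc n))"] by (auto simp: m_def)
  then obtain u where u: "\<And>n. q (u n) < m + inverse (real (Suc n))"
    by metis
  \<comment> \<open>By the parallelogram law, \<open>q\<close> at the midpoint falls short of the
    average of \<open>q x\<close> and \<open>q y\<close> by an eighth of the squared distance. It
    cannot fall below \<open>m\<close>, so near-minimizers are close together.\<close>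
  have dist_le: "(norm (x - y))\<^sup>2 \<le> 4 * (q x - m) + 4 * (q y - m)" for x y
  proof -
    have "q ((1/2) *\<^sub>R (x + y)) = (q x + q y) / 2 - (norm (x - y))\<^sup>2 / 8"
      unfolding q_def power2_norm_eq_inner
      by (simp add: f.scaleR f.add inner_add inner_diff inner_commute[of y x] field_simps)
    then show ?thesis using m_le[of "(1/2) *\<^sub>R (x + y)"] by (simp add: field_simps)
  qed
  have "Cauchy u"
  proof (rule metric_CauchyI)
    fix e :: real assume "e > 0"
    \<comment> \<open>The constant 8 makes each of the two terms in \<open>dist_le\<close> less than
      half of \<open>e\<^sup>2\<close>.\<close>
    obtain N where N: "inverse (real (Suc N)) < e\<^sup>2 / 8"
      using reals_Archimedean[of "e\<^sup>2 / 8"] \<open>e > 0\<close> by auto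
    have *: "4 * (q (u n) - m) < e\<^sup>2 / 2" if "n \<ge> N" for n
    proof -
      have "inverse (real (Suc n)) \<le> inverse (real (Suc N))" using that by simp
      then have "q (u n) - m < e\<^sup>2 / 8" using u[of n] N by linarith
      then show ?thesis by simp
    qed
    show "\<exists>N. \<forall>k\<ge>N. \<forall>n\<ge>N. dist (u k) (u n) < e"
    proof (intro exI allI impI)
      fix k n assume "k \<ge> N" "n \<ge> N"
      then have "(norm (u k - u n))\<^sup>2 < e\<^sup>2"
        using dist_le[of "u k" "u n"] *[of k] *[of n] by linarith
      then show "dist (u k) (u n) < e"
        using \<open>e > 0\<close> by (simp add: dist_norm power2_less_imp_less)
    qed
  qed
  then obtain z where z: "u \<longlonglongrightarrow> z"
    using Cauchy_convergent convergent_def by blast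
  have "(\<lambda>n. q (u n)) \<longlonglongrightarrow> q z"
    unfolding q_def by (intro tendsto_intros f.tendsto z) simp
  moreover have "(\<lambda>n. m + inverse (real (Suc n))) \<longlonglongrightarrow> m + 0"
    by (intro tendsto_intros LIMSEQ_inverse_real_of_nat)
  ultimately have "q z \<le> m + 0"
    by (rule LIMSEQ_le) (use u less_imp_le in blast)
  then have z_min: "q z \<le> q x" for x using m_le[of x] by simp
  have "f x = inner x z" for x
  proof (rule ccontr)
    define d where "d = f x - inner x z"
    define s where "s = (norm x)\<^sup>2"
    assume "f x \<noteq> inner x z"
    then have "d \<noteq> 0" by (simp add: d_def)
    have expand: "q (z + t *\<^sub>R x) = q z - t * d + t\<^sup>2 * s / 2" for t
      unfolding q_def d_def s_def power2_norm_eq_inner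
      by (simp add: f.scaleR f.add inner_add inner_commute[of z x] power2_eq_square field_simps)
    have s: "s \<ge> 0" by (simp add: s_def)
    \<comment> \<open>The quadratic in \<open>expand\<close> has slope \<open>- d\<close> at 0, and
      for \<open>s > 0\<close> its minimum is at \<open>d / s\<close>. Using \<open>s + 1\<close>
      keeps the denominator positive, and \<open>q\<close> still decreases strictly.\<close>
    let ?t = "d / (s + 1)"
    have "q (z + ?t *\<^sub>R x) = q z - d\<^sup>2 * (s + 2) / (2 * (s + 1)\<^sup>2)"
    proof -
      have "r \<noteq> 0 \<Longrightarrow> - (d / r) * d + (d / r)\<^sup>2 * (r - 1) / 2 = - (d\<^sup>2 * (r + 1) / (2 * r\<^sup>2))" for r
        by (simp add: field_simps power2_eq_square)
      from this[of "s + 1"] show ?thesis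
        unfolding expand using s by (simp add: add.assoc)
    qed
    moreover have "d\<^sup>2 * (s + 2) / (2 * (s + 1)\<^sup>2) > 0"
      using s \<open>d \<noteq> 0\<close> by (intro divide_pos_pos mult_pos_pos) auto
    ultimately show False using z_min[of "z + ?t *\<^sub>R x"] by linarith
  qed
  then show ?thesis by blast
qed

text \<open>A vector fixed by \<open>F\<close> is orthogonal to itself, hence zero.\<close>

lemma skew_shift_inj:
  fixes F :: "'a::real_inner \<Rightarrow> 'a"
  assumes F: "linear F" and skew: "\<And>x. inner x (F x) = 0"
  shows "inj (\<lambda>x. x - F x)"
proof (rule injI)
  fix x y assume "x - F x = y - F y"
  then have "x - y = F (x - y)"
    by (simp add: linear_diff[OF F] algebra_simps)
  then have "inner (x - y) (x - y) = 0" using skew[of "x - y"] by simp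
  then show "x = y" by simp
qed

text \<open>A solution of \<open>x - F x = b\<close> is a fixed point of \<open>x \<mapsto> x - t (x - F x - b)\<close>, which is a
  contraction for small \<open>t > 0\<close> because \<open>\<parallel>(1 - t) x + t F x\<parallel>\<^sup>2 = (1 - t)\<^sup>2 \<parallel>x\<parallel>\<^sup>2 + t\<^sup>2 \<parallel>F x\<parallel>\<^sup>2\<close>.\<close>

lemma skew_shift_surj:
  fixes F :: "'a::{real_inner,complete_space} \<Rightarrow> 'a"
  assumes F: "bounded_linear F" and skew: "\<And>x. inner x (F x) = 0"
  shows "surj (\<lambda>x. x - F x)"
proof -
  interpret F: bounded_linear F by (rule F)
  obtain K where K: "\<And>x. norm (F x) \<le> norm x * K" "K > 0"
    using F.pos_bounded by auto
  \<comment> \<open>This \<open>t\<close> minimizes (1 - t)^2 + t^2 K^2; the minimum is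
    \<open>1 - t\<close>, the square of the contraction constant \<open>c\<close> below.\<close>
  define t where "t = 1 / (1 + K\<^sup>2)"
  have K1: "1 + K\<^sup>2 > 0" by (simp add: add_pos_nonneg)
  have t: "0 < t" "t \<le> 1" using K1 by (auto simp: t_def)
  define c where "c = sqrt (1 - t)"
  have c: "0 \<le> c" "c < 1" using t by (auto simp: c_def)
  have "(1 - t)\<^sup>2 + t\<^sup>2 * K\<^sup>2 = 1 - 2 * t + t * (t * (1 + K\<^sup>2))"
    by (simp add: power2_eq_square algebra_simps)
  also have "t * (1 + K\<^sup>2) = 1" using K1 by (simp add: t_def)
  finally have tK: "(1 - t)\<^sup>2 + t\<^sup>2 * K\<^sup>2 = 1 - t" by simp
  have contr: "norm ((1 - t) *\<^sub>R x + t *\<^sub>R F x) \<le> c * norm x" for x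
  proof (rule power2_le_imp_le)
    have "(norm ((1 - t) *\<^sub>R x + t *\<^sub>R F x))\<^sup>2 = (1 - t)\<^sup>2 * (norm x)\<^sup>2 + t\<^sup>2 * (norm (F x))\<^sup>2"
      unfolding power2_norm_eq_inner
      by (simp add: inner_add skew inner_commute[of "F x" x] power2_eq_square)
    also have "\<dots> \<le> (1 - t)\<^sup>2 * (norm x)\<^sup>2 + t\<^sup>2 * (norm x * K)\<^sup>2"
      by (intro add_left_mono mult_left_mono power_mono K) auto
    also have "\<dots> = ((1 - t)\<^sup>2 + t\<^sup>2 * K\<^sup>2) * (norm x)\<^sup>2"
      by (simp add: algebra_simps)
    also have "\<dots> = (c * norm x)\<^sup>2"
      using t by (simp add: tK c_def power_mult_distrib)
    finally show "(norm ((1 - t) *\<^sub>R x + t *\<^sub>R F x))\<^sup>2 \<le> (c * norm x)\<^sup>2" .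
    show "0 \<le> c * norm x" using c by simp
  qed
  have "\<exists>x. b = x - F x" for b
  proof -
    let ?g = "\<lambda>x. (1 - t) *\<^sub>R x + t *\<^sub>R F x + t *\<^sub>R b"
    have "dist (?g x) (?g y) \<le> c * dist x y" for x y
    proof -
      have "?g x - ?g y = (1 - t) *\<^sub>R (x - y) + t *\<^sub>R F (x - y)"
        by (simp add: F.diff algebra_simps)
      then show ?thesis using contr[of "x - y"] by (simp add: dist_norm)
    qed
    then have "\<exists>!x. ?g x = x"
      using c by (intro banach_fix_type) auto
    then obtain x where "?g x = x" by blast
    then have "t *\<^sub>R (x - F x - b) = 0" by (simp add: algebra_simps)
    then have "b = x - F x" using t by simp
    then show ?thesis by blast
  qed
  then show ?thesis by (simp add: surj_def)
qed


section \<open>Linear operators and adjoints\<close>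

lemma csubspace_diff: "x - y \<in> S" if "csubspace S" "x \<in> S" "y \<in> S"
proof -
  have "x + (-1) *\<^sub>C y \<in> S" using that unfolding csubspace_def by blast
  then show ?thesis by (simp add: scaleC_minus1_left)
qed

lemma csubspace_minus: "- y \<in> S" if "csubspace S" "y \<in> S"
  using csubspace_diff[of S 0 y] that by (simp add: csubspace_def)

lemma linear_op_diff:
  assumes "linear_op T" "x \<in> dom T" "y \<in> dom T"
  shows "the (T (x - y)) = the (T x) - the (T y)"
proof -
  have "x - y \<in> dom T" using assms csubspace_diff unfolding linear_op_def by blast
  then have "the (T (x - y + y)) = the (T (x - y)) + the (T y)"
    using assms unfolding linear_op_def by blast
  then show ?thesis by simp
qed

lemma linear_op_zero: "the (T 0) = 0" if "linear_op T"
  using linear_op_diff[OF that, of 0 0] that by (simp add: linear_op_def csubspace_def)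

lemma linear_op_minus: "the (T (- y)) = - the (T y)" if "linear_op T" "y \<in> dom T"
  using linear_op_diff[OF that(1), of 0 y] that linear_op_zero[OF that(1)]
  by (simp add: linear_op_def csubspace_def)

text \<open>Density makes the representing vector unique, so exhibiting one \<open>z\<close> both
  places \<open>y\<close> in the domain of the adjoint and evaluates the description operator in
  \<open>adj\<close>.\<close>

lemma adj_eqI:
  assumes T: "densely_defined T" and z: "\<And>x. x \<in> dom T \<Longrightarrow> cinner (the (T x)) y = cinner x z"
  shows "adj T y = Some z"
proof -
  have "(THE z. \<forall>x\<in>dom T. cinner (the (T x)) y = cinner x z) = z"
  proof (rule the_equality)
    fix w assume "\<forall>x\<in>dom T. cinner (the (T x)) y = cinner x w"
    then have "w - z = 0"
      using z T by (intro cinner_dense_eq_0[of "dom T"])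
        (auto simp: densely_defined_def cinner_diff_right)
    then show "w = z" by simp
  qed (use z in auto)
  then show ?thesis using z unfolding adj_def by auto
qed

lemma cinner_adj:
  assumes T: "densely_defined T" and "y \<in> dom (adj T)" "x \<in> dom T"
  shows "cinner (the (T x)) y = cinner x (the (adj T y))"
proof -
  obtain z where z: "\<forall>x\<in>dom T. cinner (the (T x)) y = cinner x z"
    using assms(2) by (fastforce simp: adj_def dom_def split: if_splits)
  then have "adj T y = Some z" by (intro adj_eqI T) auto
  then show ?thesis using z assms(3) by auto
qed

lemma linear_op_adj:
  assumes T: "densely_defined T"
  shows "linear_op (adj T)"
proof -
  have zero: "adj T 0 = Some 0"
    by (rule adj_eqI[OF T]) simp
  have add: "adj T (x + y) = Some (the (adj T x) + the (adj T y))"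
    if "x \<in> dom (adj T)" "y \<in> dom (adj T)" for x y
    by (rule adj_eqI[OF T]) (simp add: cinner_add_right cinner_adj[OF T] that)
  have scale: "adj T (c *\<^sub>C x) = Some (c *\<^sub>C the (adj T x))" if "x \<in> dom (adj T)" for c x
    by (rule adj_eqI[OF T]) (simp add: cinner_scaleC_right cinner_adj[OF T] that)
  show ?thesis
    unfolding linear_op_def csubspace_def using zero add scale by (simp add: domIff)
qed

text \<open>Riesz is applied to the real part of the functional. Its vector also represents the
  imaginary part, by substituting \<open>\<i> *\<^sub>C x\<close> for \<open>x\<close> and using
  complex linearity of \<open>F\<close>.\<close>

lemma cinner_bounded_adj:
  fixes F :: "'a::chilbert_space \<Rightarrow> 'b::chilbert_space"
  assumes F: "bounded_clinear F"
  shows "cinner x (bounded_adj F y) = cinner (F x) y"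
proof -
  have lin: "bounded_linear (\<lambda>x. inner (F x) y)"
    using F unfolding bounded_clinear_def
    by (intro bounded_linear_compose[OF bounded_linear_inner_left]) auto
  obtain z where z: "\<And>x. inner (F x) y = inner x z"
    using riesz_representation[OF lin] by auto
  have "cinner (F x) y = cinner x z" for x
  proof (rule complex_eqI)
    show "Re (cinner (F x) y) = Re (cinner x z)"
      using z[of x] by (simp add: inner_eq_Re_cinner)
    show "Im (cinner (F x) y) = Im (cinner x z)"
      using z[of "\<i> *\<^sub>C x"] F by (simp add: Im_cinner bounded_clinear_def)
  qed
  moreover have "densely_defined (total_op F)"
    by (simp add: densely_defined_def total_op_def dom_def)
  ultimately have "adj (total_op F) y = Some z"
    by (intro adj_eqI) (auto simp: total_op_def)
  then show ?thesis
    using \<open>\<And>x. cinner (F x) y = cinner x z\<close> by (simp add: bounded_adj_def)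
qed

lemma bounded_clinear_bounded_adj:
  fixes F :: "'a::chilbert_space \<Rightarrow> 'b::chilbert_space"
  assumes F: "bounded_clinear F"
  shows "bounded_clinear (bounded_adj F)"
proof -
  let ?G = "bounded_adj F"
  have scale: "?G (c *\<^sub>C x) = c *\<^sub>C ?G x" for c x
    by (rule cinner_all_eqD) (simp add: cinner_bounded_adj[OF F] cinner_scaleC_right)
  obtain K where K: "\<And>x. norm (F x) \<le> norm x * K" "K > 0"
    using F bounded_linear.pos_bounded unfolding bounded_clinear_def by blast
  have "bounded_linear ?G"
  proof (rule bounded_linear_intro)
    show "?G (x + y) = ?G x + ?G y" for x y
      by (rule cinner_all_eqD) (simp add: cinner_bounded_adj[OF F] cinner_add_right)
    show "?G (r *\<^sub>R x) = r *\<^sub>R ?G x" for r x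
      by (simp add: scaleR_scaleC scale)
    \<comment> \<open>Cauchy-Schwarz on \<open>inner (F (?G y)) y\<close> bounds the square of
      \<open>norm (?G y)\<close>; one factor is then cancelled, whence the case split. The bound
      \<open>K\<close> of \<open>F\<close> carries over to the adjoint.\<close>
    show "norm (?G y) \<le> norm y * K" for y
    proof (cases "?G y = 0")
      case False
      have "norm (?G y) * norm (?G y) = inner (F (?G y)) y"
        by (metis cinner_bounded_adj[OF F] inner_eq_Re_cinner power2_norm_eq_inner power2_eq_square)
      also have "\<dots> \<le> norm (F (?G y)) * norm y"
        by (rule norm_cauchy_schwarz)
      also have "\<dots> \<le> norm (?G y) * K * norm y"
        by (intro mult_right_mono K) simp
      finally have "norm (?G y) * norm (?G y) \<le> norm (?G y) * (norm y * K)"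
        by (simp add: mult_ac)
      then show ?thesis using False by simp
    qed (use K in simp)
  qed
  then show ?thesis using scale by (simp add: bounded_clinear_def)
qed

lemma bounded_clinear_skew_block:
  assumes X: "bounded_clinear X"
  shows "bounded_clinear (skew_block X)"
proof -
  have lin: "bounded_linear X" "bounded_linear (bounded_adj X)"
    using X bounded_clinear_bounded_adj[OF X] by (auto simp: bounded_clinear_def)
  have "bounded_linear (\<lambda>x. (- bounded_adj X (snd x), X (fst x)))"
    by (intro bounded_linear_Pair bounded_linear_minus bounded_linear_compose[OF lin(1)]
        bounded_linear_compose[OF lin(2)] bounded_linear_fst bounded_linear_snd)
  then show ?thesis
    using X bounded_clinear_bounded_adj[OF X]
    by (simp add: bounded_clinear_def skew_block_def case_prod_beta' scaleC_prod_def
        scaleC_minus_right)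
qed

text \<open>The two off-diagonal terms are complex conjugates with opposite signs, so their sum is
  purely imaginary. Vanishing of the real \<open>inner\<close> is exactly what the two shift lemmas
  ask for.\<close>

lemma inner_skew_block: "inner x (skew_block X x) = 0" if "bounded_clinear X"
proof -
  have "inner (fst x) (bounded_adj X (snd x)) = inner (X (fst x)) (snd x)"
    by (simp add: inner_eq_Re_cinner cinner_bounded_adj[OF that])
  then show ?thesis
    by (simp add: inner_prod_def skew_block_def case_prod_beta inner_commute)
qed


section \<open>Block operators and graph subspaces\<close>

lemma dom_block_diag: "dom (block_diag A0 A1) = dom A0 \<times> dom A1"
  by (auto simp: block_diag_def split: if_splits)

text \<open>Self-adjointness supplies linearity of the block operator as a whole; padding vectors
  with 0 recovers it for each entry.\<close>

lemma linear_op_block_diagD: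
  assumes "linear_op (block_diag A0 A1)"
  shows "linear_op A0" "linear_op A1"
proof -
  have ev: "block_diag A0 A1 (f, g) = Some (the (A0 f), the (A1 g))"
    if "f \<in> dom A0" "g \<in> dom A1" for f g
    using that by (simp add: block_diag_def)
  have S: "csubspace (dom A0 \<times> dom A1)"
    and add: "\<And>x y. x \<in> dom A0 \<times> dom A1 \<Longrightarrow> y \<in> dom A0 \<times> dom A1 \<Longrightarrow>
      the (block_diag A0 A1 (x + y)) = the (block_diag A0 A1 x) + the (block_diag A0 A1 y)"
    and scale: "\<And>c x. x \<in> dom A0 \<times> dom A1 \<Longrightarrow>
      the (block_diag A0 A1 (c *\<^sub>C x)) = c *\<^sub>C the (block_diag A0 A1 x)"
    using assms unfolding linear_op_def dom_block_diag by blast+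
  have S0: "csubspace (dom A0)" and S1: "csubspace (dom A1)"
    using S unfolding csubspace_def zero_prod_def
    by (simp_all add: scaleC_prod_def) blast+
  have z: "0 \<in> dom A0" "0 \<in> dom A1" using S0 S1 by (auto simp: csubspace_def)
  have "the (A0 (x + y)) = the (A0 x) + the (A0 y)" if "x \<in> dom A0" "y \<in> dom A0" for x y
    using add[of "(x, 0)" "(y, 0)"] that z S0 by (simp add: ev csubspace_def)
  moreover have "the (A0 (c *\<^sub>C x)) = c *\<^sub>C the (A0 x)" if "x \<in> dom A0" for c x
    using scale[of "(x, 0)" c] that z S0 by (simp add: ev csubspace_def scaleC_prod_def)
  ultimately show "linear_op A0" using S0 by (simp add: linear_op_def)
  have "the (A1 (x + y)) = the (A1 x) + the (A1 y)" if "x \<in> dom A1" "y \<in> dom A1" for x y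
    using add[of "(0, x)" "(0, y)"] that z S1 by (simp add: ev csubspace_def)
  moreover have "the (A1 (c *\<^sub>C x)) = c *\<^sub>C the (A1 x)" if "x \<in> dom A1" for c x
    using scale[of "(0, x)" c] that z S1 by (simp add: ev csubspace_def scaleC_prod_def)
  ultimately show "linear_op A1" using S1 by (simp add: linear_op_def)
qed

lemma dom_block_offdiag: "dom (block_offdiag B C) = dom C \<times> dom B"
  by (auto simp: block_offdiag_def split: if_splits)

lemma linear_op_block_offdiag:
  assumes "linear_op B" "linear_op C"
  shows "linear_op (block_offdiag B C)"
proof -
  have ev: "block_offdiag B C (f, g) = Some (the (B g), the (C f))"
    if "f \<in> dom C" "g \<in> dom B" for f g
    using that by (simp add: block_offdiag_def)
  show ?thesis
    using assms unfolding linear_op_def csubspace_def dom_block_offdiag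
    by (simp add: zero_prod_def scaleC_prod_def ev)
qed

text \<open>Moving \<open>X\<close> to the other side, the inner product of \<open>(f, X f)\<close>
  with \<open>(u, v)\<close> is that of \<open>f\<close> with
  \<open>u + bounded_adj X v\<close>.\<close>

lemma orth_compl_graph:
  assumes X: "bounded_clinear X"
  shows "orth_compl (graph_subspace X) = {(- bounded_adj X g, g) | g. True}"
proof -
  have "(u, v) \<in> orth_compl (graph_subspace X) \<longleftrightarrow> u = - bounded_adj X v" for u v
  proof -
    have "(u, v) \<in> orth_compl (graph_subspace X) \<longleftrightarrow>
        (\<forall>f. cinner f (u + bounded_adj X v) = cinner f 0)"
      by (auto simp: orth_compl_def graph_subspace_def cinner_prod_def cinner_add_right
          cinner_bounded_adj[OF X])
    also have "\<dots> \<longleftrightarrow> u + bounded_adj X v = 0"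
      by (auto intro: cinner_all_eqD)
    finally show ?thesis by (simp add: add_eq_0_iff2)
  qed
  then show ?thesis by auto
qed

lemma closed_graph_subspace: "closed (graph_subspace X)" if "bounded_clinear X"
proof -
  have "graph_subspace X = {p. snd p = X (fst p)}"
    by (auto simp: graph_subspace_def)
  moreover have "continuous_on UNIV (\<lambda>p. X (fst p))"
    using that unfolding bounded_clinear_def
    by (intro bounded_linear.continuous_on[of X] continuous_on_fst continuous_on_id) simp
  then have "closed {p. snd p = X (fst p)}"
    by (intro closed_Collect_eq continuous_on_snd continuous_on_id)
  ultimately show ?thesis by simp
qed

lemma csubspace_graph_subspace: "csubspace (graph_subspace X)" if "bounded_clinear X"
  using that bounded_linear.linear[of X]
  by (auto simp: csubspace_def graph_subspace_def bounded_clinear_def zero_prod_def scaleC_prod_def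
      linear_add linear_0)

lemma dom_op_add: "dom (S \<^bold>+ T) = dom S \<inter> dom T"
  by (auto simp: op_add_def split: if_splits)

text \<open>The left side minus the right side is the negative of the Riccati expression at
  \<open>x\<close>; the scalar terms cancel because \<open>Y\<close> is complex linear. The form is
  pointwise because in (a) \<open>Y x \<in> dom A\<close> is at first known only for some
  \<open>x\<close>.\<close>

lemma riccati_intertwining:
  assumes A: "linear_op A" and V: "linear_op V" and "dom A \<subseteq> dom V" and Y: "bounded_clinear Y"
    and x: "x \<in> dom A" "Y x \<in> dom A"
    and ric: "the (A (Y x)) - Y (the (A x)) - Y (the (V (Y x))) + the (V x) = 0"
  shows "the (A (x - Y x)) - Y (the (V (x - Y x))) - l *\<^sub>C (x - Y x)
    = (the (A x) + the (V x) - l *\<^sub>C x) - Y (the (A x) + the (V x) - l *\<^sub>C x)"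
proof -
  interpret Y: bounded_linear Y using Y by (simp add: bounded_clinear_def)
  have "Y (l *\<^sub>C x) = l *\<^sub>C Y x" using Y by (simp add: bounded_clinear_def)
  moreover have "x \<in> dom V" "Y x \<in> dom V" using assms by auto
  ultimately show ?thesis
    using x ric
    by (simp add: linear_op_diff[OF A] linear_op_diff[OF V] scaleC_diff_right Y.add Y.diff
        algebra_simps)
qed

text \<open>Together with \<open>ran_restrict_Some\<close>, this trades partial maps for total
  functions on an explicit domain.\<close>

lemma inj_on_restrict_Some:
  "inj_on (\<lambda>x. if x \<in> S then Some (F x) else None) (dom (\<lambda>x. if x \<in> S then Some (F x) else None))
    \<longleftrightarrow> inj_on F S"
proof -
  have "dom (\<lambda>x. if x \<in> S then Some (F x) else None) = S"
    by (auto split: if_splits)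
  then show ?thesis by (simp add: inj_on_def)
qed

lemma ran_restrict_Some: "ran (\<lambda>x. if x \<in> S then Some (F x) else None) = F ` S"
  by (auto simp: ran_def split: if_splits)

theorem theorem3p4:
  fixes A0 :: "'a::chilbert_space \<rightharpoonup> 'a"
    and A1 :: "'b::chilbert_space \<rightharpoonup> 'b"
    and W :: "'b \<rightharpoonup> 'a"
    and X :: "'a \<Rightarrow> 'b"
    and A V :: "'a \<times> 'b \<rightharpoonup> 'a \<times> 'b"
    and Y :: "'a \<times> 'b \<Rightarrow> 'a \<times> 'b"
  assumes A: "A = block_diag A0 A1" "self_adjoint A"
    and W: "linear_op W" "densely_defined W" "dom A1 \<subseteq> dom W" "dom A0 \<subseteq> dom (adj W)"
    and V: "V = block_offdiag W (adj W)"
    and X: "bounded_clinear X"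
    and Y: "Y = skew_block X"
  shows "(reducing_for (graph_subspace X) (A \<^bold>+ V) \<longrightarrow>
            (\<exists>l::complex.
               inj_on (A \<^bold>+ V \<^bold>- scalar_op l) (dom (A \<^bold>+ V \<^bold>- scalar_op l)) \<and>
               ran (A \<^bold>- (total_op Y \<circ>\<^sub>m V) \<^bold>- scalar_op l) = UNIV) \<longrightarrow>
            strong_riccati_solution A V Y)
       \<and> (strong_riccati_solution A V Y \<longrightarrow>
            (\<exists>l::complex.
               ran (A \<^bold>+ V \<^bold>- scalar_op l) = UNIV \<and>
               inj_on (A \<^bold>- (total_op Y \<circ>\<^sub>m V) \<^bold>- scalar_op l)
                 (dom (A \<^bold>- (total_op Y \<circ>\<^sub>m V) \<^bold>- scalar_op l))) \<longrightarrow>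
            reducing_for (graph_subspace X) (A \<^bold>+ V))"
proof -

  \<comment> \<open>Domains, linearity and evaluation of the blocks\<close>
  let ?D = "dom A" and ?Z = "bounded_adj X"
  \<comment> \<open>\<open>?B l\<close> and \<open>?C l\<close> are total functions standing on
    \<open>?D\<close> for A + V - l and A - YV - l.\<close>
  let ?B = "\<lambda>l x. the (A x) + the (V x) - l *\<^sub>C x"
  let ?C = "\<lambda>l x. the (A x) - Y (the (V x)) - l *\<^sub>C x"
  let ?G = "graph_subspace X"
  have D: "?D = dom A0 \<times> dom A1" by (simp add: A dom_block_diag)
  have DV: "?D \<subseteq> dom V" using W by (auto simp: V D dom_block_offdiag)
  have linA: "linear_op A" using A(2) by (simp add: self_adjoint_def)
  then have lin0: "linear_op A0" and lin1: "linear_op A1"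
    unfolding A(1) by (rule linear_op_block_diagD)+
  have linW': "linear_op (adj W)" by (rule linear_op_adj[OF W(2)])
  have linV: "linear_op V" unfolding V by (intro linear_op_block_offdiag linW' W)
  have subD: "csubspace ?D" and sub0: "csubspace (dom A0)" and sub1: "csubspace (dom A1)"
    using linA lin0 lin1 by (simp_all add: linear_op_def)
  have zero: "0 \<in> dom A0" "0 \<in> dom A1" using sub0 sub1 by (simp_all add: csubspace_def)
  have min0: "- f \<in> dom A0 \<longleftrightarrow> f \<in> dom A0" and min1: "- g \<in> dom A1 \<longleftrightarrow> g \<in> dom A1" for f g
    using csubspace_minus[OF sub0, of f] csubspace_minus[OF sub0, of "- f"]
      csubspace_minus[OF sub1, of g] csubspace_minus[OF sub1, of "- g"] by auto
  have neg: "the (A0 (- f)) = - the (A0 f)" "the (adj W (- f)) = - the (adj W f)"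
    if "f \<in> dom A0" for f
    using that W by (auto intro!: linear_op_minus lin0 linW')
  have bY: "bounded_clinear Y" unfolding Y by (rule bounded_clinear_skew_block[OF X])
  interpret Y: bounded_linear Y using bY by (simp add: bounded_clinear_def)
  interpret X: bounded_linear X using X by (simp add: bounded_clinear_def)
  interpret Z: bounded_linear "?Z"
    using bounded_clinear_bounded_adj[OF X] by (simp add: bounded_clinear_def)
  have skew: "inner x (Y x) = 0" for x unfolding Y by (rule inner_skew_block[OF X])
  have inj_T: "inj (\<lambda>x. x - Y x)" by (rule skew_shift_inj[OF Y.linear skew])
  have surj_T: "surj (\<lambda>x. x - Y x)" by (rule skew_shift_surj[OF Y.bounded_linear_axioms skew])
  have Y_eq: "Y (f, g) = (- ?Z g, X f)" for f g by (simp add: Y skew_block_def)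
  have A_eq: "the (A (f, g)) = (the (A0 f), the (A1 g))"
    and V_eq: "the (V (f, g)) = (the (W g), the (adj W f))"
    if "f \<in> dom A0" "g \<in> dom A1" for f g
    using that W by (auto simp: A V block_diag_def block_offdiag_def)
  have dom_AV: "dom (A \<^bold>+ V) = ?D" using DV by (auto simp: dom_op_add)
  have AV_eq: "the ((A \<^bold>+ V) (f, g)) = (the (A0 f) + the (W g), the (A1 g) + the (adj W f))"
    if "f \<in> dom A0" "g \<in> dom A1" for f g
  proof -
    have "(f, g) \<in> ?D \<inter> dom V" using that DV by (auto simp: D)
    then show ?thesis by (simp add: op_add_def A_eq V_eq that)
  qed

  \<comment> \<open>The shifted operators and the intertwining relation\<close>
  have B: "(A \<^bold>+ V \<^bold>- scalar_op l) x = (if x \<in> ?D then Some (?B l x) else None)"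
    and C: "(A \<^bold>- (total_op Y \<circ>\<^sub>m V) \<^bold>- scalar_op l) x = (if x \<in> ?D then Some (?C l x) else None)"
    for l x
  proof -
    have "x \<in> dom V" if "x \<in> ?D" using that DV by blast
    then show "(A \<^bold>+ V \<^bold>- scalar_op l) x = (if x \<in> ?D then Some (?B l x) else None)"
      "(A \<^bold>- (total_op Y \<circ>\<^sub>m V) \<^bold>- scalar_op l) x = (if x \<in> ?D then Some (?C l x) else None)"
      by (cases "A x"; cases "V x";
          simp add: op_add_def op_diff_def scalar_op_def total_op_def map_comp_def domIff)+
  qed
  let ?ric = "\<lambda>x. the (A (Y x)) - Y (the (A x)) - Y (the (V (Y x))) + the (V x)"
  have twine: "?C l (x - Y x) = ?B l x - Y (?B l x)"
    if "x \<in> ?D" "Y x \<in> ?D" "?ric x = 0" for l x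
    by (rule riccati_intertwining[OF linA linV DV bY that])

  \<comment> \<open>The Riccati equation and invariance in components\<close>
  have ric_eq: "?ric (f, g) =
      (- the (A0 (?Z g)) + ?Z (the (A1 g)) - ?Z (the (adj W (?Z g))) + the (W g),
       the (A1 (X f)) - X (the (A0 f)) - X (the (W (X f))) + the (adj W f))"
    if "f \<in> dom A0" "g \<in> dom A1" "?Z g \<in> dom A0" "X f \<in> dom A1" for f g
    using that by (simp add: Y_eq A_eq V_eq Z.neg min0 neg)
  have G_mem: "(u, v) \<in> ?G \<longleftrightarrow> v = X u"
    and Gp_mem: "(u, v) \<in> orth_compl ?G \<longleftrightarrow> u = - ?Z v" for u v
    unfolding orth_compl_graph[OF X] by (auto simp: graph_subspace_def)
  have inv: "invariant_for S (A \<^bold>+ V) \<longleftrightarrow> (\<forall>f\<in>dom A0. \<forall>g\<in>dom A1. (f, g) \<in> S \<longrightarrow>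
      (the (A0 f) + the (W g), the (A1 g) + the (adj W f)) \<in> S)" for S
  proof -
    have "invariant_for S (A \<^bold>+ V) \<longleftrightarrow> (\<forall>x\<in>?D. x \<in> S \<longrightarrow> the ((A \<^bold>+ V) x) \<in> S)"
      unfolding invariant_for_def dom_AV by blast
    then show ?thesis by (simp add: D AV_eq)
  qed
  \<comment> \<open>The Riccati expression decouples: its second component involves only
    \<open>f\<close>, its first only \<open>g\<close>. Vanishing of the second is invariance of the
    graph; vanishing of the first is invariance of the orthogonal complement
    (\<open>inv_Gp\<close>).\<close>
  have inv_G: "invariant_for ?G (A \<^bold>+ V) \<longleftrightarrow>
      (\<forall>f. f \<in> dom A0 \<longrightarrow> X f \<in> dom A1 \<longrightarrow>
        the (A1 (X f)) + the (adj W f) = X (the (A0 f) + the (W (X f))))"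
    unfolding inv G_mem by blast
  have inv_Gp: "invariant_for (orth_compl ?G) (A \<^bold>+ V) \<longleftrightarrow>
      (\<forall>g. ?Z g \<in> dom A0 \<longrightarrow> g \<in> dom A1 \<longrightarrow>
        - the (A0 (?Z g)) + the (W g) = - ?Z (the (A1 g) - the (adj W (?Z g))))"
  proof -
    have "invariant_for (orth_compl ?G) (A \<^bold>+ V) \<longleftrightarrow>
        (\<forall>g. - ?Z g \<in> dom A0 \<longrightarrow> g \<in> dom A1 \<longrightarrow>
          the (A0 (- ?Z g)) + the (W g) = - ?Z (the (A1 g) + the (adj W (- ?Z g))))"
      unfolding inv Gp_mem by blast
    then show ?thesis by (simp add: min0 neg)
  qed

  \<comment> \<open>Part (a): from a reducing graph to the Riccati equation\<close>
  have part_a: "strong_riccati_solution A V Y"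
    if red: "reducing_for ?G (A \<^bold>+ V)"
      and inj: "inj_on (?B l) ?D" and sur: "?C l ` ?D = UNIV" for l
  proof -
    have ric: "?ric (f, g) = 0"
      if "f \<in> dom A0" "g \<in> dom A1" "?Z g \<in> dom A0" "X f \<in> dom A1" for f g
      using red that ric_eq[OF that] unfolding reducing_for_def inv_G inv_Gp
      by (simp add: X.add Z.diff zero_prod_def algebra_simps)
    have splitting: "\<exists>f g. f \<in> dom A0 \<and> X f \<in> dom A1 \<and> ?Z g \<in> dom A0 \<and> g \<in> dom A1 \<and>
        p = (f, g) - Y (f, g)" if p: "p \<in> ?D" for p
    proof -
      obtain a b where ab: "p = (a, b)" "a \<in> dom A0" "b \<in> dom A1" using p D by auto
      \<comment> \<open>The splitting of \<open>D\<close> is by \<open>I + Y\<close>; flipping the sign of the second component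
        conjugates it to \<open>I - Y\<close>.\<close>
      have "(a, - b) \<in> ?D" using ab by (simp add: D min1)
      moreover have "?D = {u + v | u v. u \<in> ?D \<inter> ?G \<and> v \<in> ?D \<inter> orth_compl ?G}"
        using red unfolding reducing_for_def dom_AV by blast
      ultimately obtain u v where uv: "(a, - b) = u + v" "u \<in> ?D" "u \<in> ?G"
        "v \<in> ?D" "v \<in> orth_compl ?G"
        by blast
      moreover obtain f g where "u = (f, X f)" "v = (- ?Z g, g)"
        using uv(3,5) G_mem Gp_mem by (metis surj_pair)
      ultimately have fg: "(f, X f) \<in> ?D" "(- ?Z g, g) \<in> ?D" "a = f - ?Z g" "- b = X f + g"
        by simp_all
      have "b = - (X f + g)" using fg(4) by (metis minus_minus)
      then have "p = (f, - g) - Y (f, - g)"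
        using fg(3) by (simp add: ab Y_eq Z.neg)
      moreover have "?Z (- g) \<in> dom A0" "- g \<in> dom A1" "f \<in> dom A0" "X f \<in> dom A1"
        using fg by (simp_all add: D Z.neg min1)
      ultimately show ?thesis by blast
    qed
    show ?thesis unfolding strong_riccati_solution_def
    proof
      fix x assume x: "x \<in> ?D"
      \<comment> \<open>Surjectivity of \<open>?C l\<close> yields a preimage \<open>p\<close> of T
        applied to \<open>?B l x\<close>, and \<open>splitting\<close> writes \<open>p\<close> as T
        of some \<open>(f, g)\<close> at which the intertwining holds. Cancelling T and then
        \<open>?B l\<close> identifies \<open>x\<close> with \<open>(f, g)\<close>.\<close>
      have "?B l x - Y (?B l x) \<in> ?C l ` ?D" unfolding sur by (rule UNIV_I)
      then obtain p where p: "?B l x - Y (?B l x) = ?C l p" "p \<in> ?D" by (rule imageE)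
      obtain f g where fg: "f \<in> dom A0" "g \<in> dom A1" "?Z g \<in> dom A0" "X f \<in> dom A1"
        and p_eq: "p = (f, g) - Y (f, g)"
        using splitting[OF p(2)] by blast
      have mem: "(f, g) \<in> ?D" "Y (f, g) \<in> ?D"
        using fg by (simp_all add: D Y_eq min0)
      have "?B l x - Y (?B l x) = ?B l (f, g) - Y (?B l (f, g))"
        using twine[OF mem ric[OF fg], of l] unfolding p_eq[symmetric] p(1)[symmetric] .
      then have "?B l x = ?B l (f, g)" by (rule injD[OF inj_T])
      then have "x = (f, g)" using x mem(1) by (rule inj_onD[OF inj])
      then show "Y x \<in> ?D \<and> ?ric x = 0" using mem ric[OF fg] by auto
    qed
  qed

  \<comment> \<open>Part (b): from the Riccati equation to a reducing graph\<close>
  have part_b: "reducing_for ?G (A \<^bold>+ V)"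
    if sol: "strong_riccati_solution A V Y"
      and sur: "?B l ` ?D = UNIV" and inj: "inj_on (?C l) ?D" for l
  proof -
    have YD: "Y x \<in> ?D" and ric: "?ric x = 0" if "x \<in> ?D" for x
      using sol that by (auto simp: strong_riccati_solution_def)
    \<comment> \<open>Since \<open>?D\<close> is a product, testing \<open>Y\<close> on
      \<open>(f, 0)\<close> and \<open>(0, g)\<close> separates the domain condition into one for
      \<open>X\<close> and one for its adjoint. The same vectors isolate the components of
      \<open>?ric\<close> below.\<close>
    have XD: "X f \<in> dom A1" if "f \<in> dom A0" for f
      using YD[of "(f, 0)"] that zero by (simp add: D Y_eq)
    have ZD: "?Z g \<in> dom A0" if "g \<in> dom A1" for g
      using YD[of "(0, g)"] that zero by (simp add: D Y_eq min0)
    have invG: "invariant_for ?G (A \<^bold>+ V)"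
      unfolding inv_G
    proof (intro allI impI)
      fix f assume "f \<in> dom A0" "X f \<in> dom A1"
      then show "the (A1 (X f)) + the (adj W f) = X (the (A0 f) + the (W (X f)))"
        using ric[of "(f, 0)"] ric_eq[of f 0] zero
        by (simp add: D X.add zero_prod_def algebra_simps)
    qed
    have invGp: "invariant_for (orth_compl ?G) (A \<^bold>+ V)"
      unfolding inv_Gp
    proof (intro allI impI)
      fix g assume "?Z g \<in> dom A0" "g \<in> dom A1"
      then show "- the (A0 (?Z g)) + the (W g) = - ?Z (the (A1 g) - the (adj W (?Z g)))"
        using ric[of "(0, g)"] ric_eq[of 0 g] zero
        by (simp add: D Z.diff zero_prod_def algebra_simps)
    qed
    have T_onto: "\<exists>q\<in>?D. p = q - Y q" if p: "p \<in> ?D" for p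
    proof -
      \<comment> \<open>Pulling \<open>?C l p\<close> back through T and then through
        \<open>?B l\<close> gives \<open>q\<close>; the intertwining shows that \<open>?C l\<close>
        agrees at T \<open>q\<close> and at \<open>p\<close>.\<close>
      obtain r where r: "?C l p = r - Y r" using surj_T by (rule surjE)
      have "r \<in> ?B l ` ?D" unfolding sur by (rule UNIV_I)
      then obtain q where q: "r = ?B l q" "q \<in> ?D" by (rule imageE)
      have "q - Y q \<in> ?D" by (intro csubspace_diff subD q YD)
      moreover have "?C l (q - Y q) = ?C l p"
        unfolding twine[OF q(2) YD[OF q(2)] ric[OF q(2)]] r q(1) ..
      ultimately have "q - Y q = p" using p inj_onD[OF inj, of "q - Y q" p] by simp
      then show ?thesis using q(2) by blast
    qed
    have "?D \<subseteq> {u + v | u v. u \<in> ?D \<inter> ?G \<and> v \<in> ?D \<inter> orth_compl ?G}"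
    proof
      fix p assume "p \<in> ?D"
      then obtain a b where ab: "p = (a, b)" "a \<in> dom A0" "b \<in> dom A1" using D by auto
      \<comment> \<open>The splitting along the graph and its complement is by I + Y, whereas
        \<open>T_onto\<close> concerns I - Y. Negating the second component exchanges the two, so
        the summands found for \<open>p\<close> are built from \<open>f\<close> and
        \<open>- g\<close>.\<close>
      then have "(a, - b) \<in> ?D" by (simp add: D min1)
      then obtain q where q: "q \<in> ?D" "(a, - b) = q - Y q" using T_onto by blast
      obtain f g where fg: "q = (f, g)" "f \<in> dom A0" "g \<in> dom A1"
        using q(1) unfolding D by (rule SigmaE)
      have "- b = g - X f" using q(2) by (simp add: fg Y_eq)
      then have "b = - (g - X f)" by (metis minus_minus)
      then have "p = (f, X f) + (- ?Z (- g), - g)"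
        using q(2) by (simp add: ab fg Y_eq Z.neg)
      moreover have "(f, X f) \<in> ?D \<inter> ?G" "(- ?Z (- g), - g) \<in> ?D \<inter> orth_compl ?G"
        using fg XD[OF fg(2)] ZD[OF fg(3)] by (simp_all add: D G_mem Gp_mem Z.neg min1)
      ultimately show "p \<in> {u + v | u v. u \<in> ?D \<inter> ?G \<and> v \<in> ?D \<inter> orth_compl ?G}"
        by blast
    qed
    moreover have "{u + v | u v. u \<in> ?D \<inter> ?G \<and> v \<in> ?D \<inter> orth_compl ?G} \<subseteq> ?D"
      using subD unfolding csubspace_def by blast
    ultimately show ?thesis
      unfolding reducing_for_def dom_AV
      using invG invGp closed_graph_subspace[OF X] csubspace_graph_subspace[OF X] by blast
  qed
  show ?thesis
    unfolding B[abs_def] C[abs_def] inj_on_restrict_Some ran_restrict_Some using part_a part_b by blast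
qed

end
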